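(* Let $\{x_k\}_{k\in\mathbb{N}}$ be a sequence generated by Algorithm B (described in the context) from a starting point $x_0\in\mathrm{dom}(g)$, under the assumptions (i)–(iii) of the context. Let $\omega(x_0)$ be the set of cluster points of $\{x_k\}$, let $\mathcal{S}^*$ be the set of stationary points of $\varphi$, and put $\bar\eta=M+L_H+c+3$. Then: (a) $\|\mathcal{G}(x_k)\|\le\bar\eta\|x_{k+1}-x_k\|$ for all $k$. (b) $\varphi(x_k)-\varphi(x_{k+1})\ge\frac{c}{2}\|x_{k+1}-x_k\|^2$ for all $k$. (c) $\omega(x_0)\subseteq\mathcal{S}^*$, and $\omega(x_0)$ is nonempty, closed, and connected. (d) With $\zeta=\dfrac{2\bar\eta^2}{c}$, for every $k\in\mathbb{N}$, $$\min_{0\le j\le k}\|\mathcal{G}(x_j)\|\le\frac{\sqrt{\zeta\,(\varphi(x_0)-\varphi_* )}}{\sqrt{k+1}}.$$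
   Context: Problem: minimize $\varphi(x)=f(x)+g(x)$ over $x\in\mathbb{R}^n$; the solution set is assumed nonempty and $\varphi_*$ denotes the optimal value. $\|\cdot\|$ is the Euclidean norm (spectral norm for matrices). Assumptions. (i) $f:\mathbb{R}^n\to(-\infty,+\infty]$ is twice continuously differentiable on an open set $\Omega_1$ containing $\mathrm{dom}(g)$, and $\nabla f$ is $L_H$-Lipschitz continuous on $\Omega_1$. (ii) $g:\mathbb{R}^n\to(-\infty,+\infty]$ is proper, closed (lower semicontinuous), convex, and nonsmooth (meaning only that differentiability is not assumed). (iii) For any $x_0\in\mathrm{dom}(g)$ the level set $\{x:\varphi(x)\le\varphi(x_0)\}$ is bounded. Notation. $\mathrm{prox}_g(u)=\arg\min_x\{g(x)+\frac12\|x-u\|^2\}$. The KKT residual mapping is $\mathcal{G}(x)=x-\mathrm{prox}_g(x-\nabla f(x))$. A point $\bar x$ is stationary if $0\in\nabla f(\bar x)+\partial g(\bar x)$. For a symmetric positive definite matrix $H$, $$q(x;x_k,H)=f(x_k)+\langle\nabla f(x_k),x-x_k\rangle+g(x)+\tfrac12(x-x_k)^\top H(x-x_k).$$ Algorithm B (inexact proximal Newton method without line search). Parameters: $c>0$, $\mu_1\in(0,1]$, $\mu_2\in(0,\mu_1]$, $\delta\in[0,1]$, and symmetric positive semidefinite matrices $B_k$ with $\|B_k\|\le M$ for all $k$ (for some $M\ge0$). Put $\widehat H_k=B_k+(L_H+c+\mu_1\min\{1,\|\mathcal{G}(x_k)\|^{\delta}\})I$ (with $0^0=1$). For $k=0,1,\dots$,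 choose $x_{k+1}$ and an error vector $\varepsilon_k\in\mathbb{R}^n$ such that $$x_{k+1}=\arg\min_x\{q(x;x_k,\widehat H_k)+\varepsilon_k^\top(x-x_k)\},\qquad\|\varepsilon_k\|\le\tfrac{\mu_2}{2}\min\{1,\|\mathcal{G}(x_k)\|^{\delta}\}\|x_{k+1}-x_k\|.$$ *)

theory Defs
  imports "HOL-Analysis.Analysis"
begin

definition eff_dom :: "('a \<Rightarrow> ereal) \<Rightarrow> 'a set" where
  "eff_dom g = {x. g x < \<infinity>}"

definition proper_fun :: "('a \<Rightarrow> ereal) \<Rightarrow> bool" where
  "proper_fun g \<longleftrightarrow> eff_dom g \<noteq> {} \<and> (\<forall>x. g x \<noteq> -\<infinity>)"

definition lsc_fun :: "('a::topological_space \<Rightarrow> ereal) \<Rightarrow> bool" where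
  "lsc_fun g \<longleftrightarrow> (\<forall>x. g x \<le> Liminf (at x) g)"

definition convex_fun :: "('a::real_vector \<Rightarrow> ereal) \<Rightarrow> bool" where
  "convex_fun g \<longleftrightarrow> (\<forall>x y. \<forall>t::real. 0 < t \<and> t < 1 \<longrightarrow>
     g ((1 - t) *\<^sub>R x + t *\<^sub>R y) \<le> ereal (1 - t) * g x + ereal t * g y)"

definition subdifferential :: "('a::real_inner \<Rightarrow> ereal) \<Rightarrow> 'a \<Rightarrow> 'a set" where
  "subdifferential g x =
     {v. \<bar>g x\<bar> \<noteq> \<infinity> \<and> (\<forall>y. g x + ereal (v \<bullet> (y - x)) \<le> g y)}"

(* Only meaningful where f is finite near x and differentiable at x. *)
definition grad :: "('a::real_inner \<Rightarrow> ereal) \<Rightarrow> 'a \<Rightarrow> 'a" where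
  "grad f x = (THE D. GDERIV (\<lambda>y. real_of_ereal (f y)) x :> D)"

(* The finiteness requirement is needed because real_of_ereal sends infinite values to 0.
   The matrix-valued function H is the Hessian. *)
definition twice_cont_diff_on :: "(real^'n \<Rightarrow> ereal) \<Rightarrow> (real^'n) set \<Rightarrow> bool" where
  "twice_cont_diff_on f S \<longleftrightarrow>
     (\<forall>x\<in>S. \<bar>f x\<bar> \<noteq> \<infinity>) \<and>
     (\<forall>x\<in>S. GDERIV (\<lambda>y. real_of_ereal (f y)) x :> grad f x) \<and>
     (\<exists>H :: real^'n \<Rightarrow> real^'n^'n. continuous_on S H \<and>
        (\<forall>x\<in>S. (grad f has_derivative (\<lambda>h. H x *v h)) (at x)))"

definition obj :: "('a \<Rightarrow> ereal) \<Rightarrow> ('a \<Rightarrow> ereal) \<Rightarrow> 'a \<Rightarrow> ereal" where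
  "obj f g x = f x + g x"

definition solution_set :: "('a \<Rightarrow> ereal) \<Rightarrow> ('a \<Rightarrow> ereal) \<Rightarrow> 'a set" where
  "solution_set f g = {x. is_arg_min (obj f g) (\<lambda>_. True) x}"

definition opt_val :: "('a \<Rightarrow> ereal) \<Rightarrow> ('a \<Rightarrow> ereal) \<Rightarrow> ereal" where
  "opt_val f g = (INF x. obj f g x)"

definition prox :: "('a::real_inner \<Rightarrow> ereal) \<Rightarrow> 'a \<Rightarrow> 'a" where
  "prox g u = arg_min (\<lambda>x. g x + ereal (1/2 * (norm (x - u))\<^sup>2)) (\<lambda>_. True)"

definition kkt_residual :: "('a::real_inner \<Rightarrow> ereal) \<Rightarrow> ('a \<Rightarrow> ereal) \<Rightarrow> 'a \<Rightarrow> 'a" where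
  "kkt_residual f g x = x - prox g (x - grad f x)"

definition stationary_points :: "('a::real_inner \<Rightarrow> ereal) \<Rightarrow> ('a \<Rightarrow> ereal) \<Rightarrow> 'a set" where
  "stationary_points f g = {x. 0 \<in> (\<lambda>v. grad f x + v) ` subdifferential g x}"

definition cluster_points :: "(nat \<Rightarrow> 'a::topological_space) \<Rightarrow> 'a set" where
  "cluster_points x = {l. \<exists>r::nat \<Rightarrow> nat. strict_mono r \<and> (x \<circ> r) \<longlonglongrightarrow> l}"

definition sym_psd :: "real^'n^'n \<Rightarrow> bool" where
  "sym_psd B \<longleftrightarrow> transpose B = B \<and> (\<forall>v. 0 \<le> v \<bullet> (B *v v))"

(* norm on real^'n^'n is the Frobenius norm *)
definition spectral_norm :: "real^'n^'n \<Rightarrow> real" where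
  "spectral_norm B = onorm (\<lambda>v. B *v v)"

(* powr with the convention 0 powr 0 = 1; the library has 0 powr 0 = 0 *)
definition rpow :: "real \<Rightarrow> real \<Rightarrow> real" where
  "rpow a d = (if d = 0 then 1 else a powr d)"

definition reg_factor ::
  "(real^'n \<Rightarrow> ereal) \<Rightarrow> (real^'n \<Rightarrow> ereal) \<Rightarrow> real \<Rightarrow> real^'n \<Rightarrow> real" where
  "reg_factor f g \<delta> x = min 1 (rpow (norm (kkt_residual f g x)) \<delta>)"

definition model_matrix ::
  "(real^'n \<Rightarrow> ereal) \<Rightarrow> (real^'n \<Rightarrow> ereal) \<Rightarrow> real \<Rightarrow> real \<Rightarrow> real \<Rightarrow> real
    \<Rightarrow> real^'n^'n \<Rightarrow> real^'n \<Rightarrow> real^'n^'n" where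
  "model_matrix f g L c \<mu>1 \<delta> B x = B + (L + c + \<mu>1 * reg_factor f g \<delta> x) *\<^sub>R mat 1"

definition quad_model ::
  "(real^'n \<Rightarrow> ereal) \<Rightarrow> (real^'n \<Rightarrow> ereal) \<Rightarrow> real^'n \<Rightarrow> real^'n^'n \<Rightarrow> real^'n \<Rightarrow> ereal" where
  "quad_model f g z H x =
     f z + ereal (grad f z \<bullet> (x - z)) + g x + ereal (1/2 * ((x - z) \<bullet> (H *v (x - z))))"

definition inexact_prox_newton ::
  "(real^'n \<Rightarrow> ereal) \<Rightarrow> (real^'n \<Rightarrow> ereal) \<Rightarrow> real \<Rightarrow> real \<Rightarrow> real \<Rightarrow> real \<Rightarrow> real \<Rightarrow> real
    \<Rightarrow> (nat \<Rightarrow> real^'n^'n) \<Rightarrow> (nat \<Rightarrow> real^'n) \<Rightarrow> (nat \<Rightarrow> real^'n) \<Rightarrow> bool" where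
  "inexact_prox_newton f g L c \<mu>1 \<mu>2 \<delta> M B \<epsilon> x \<longleftrightarrow>
     (\<forall>k. sym_psd (B k) \<and> spectral_norm (B k) \<le> M) \<and>
     (\<forall>k. is_arg_min
            (\<lambda>y. quad_model f g (x k) (model_matrix f g L c \<mu>1 \<delta> (B k) (x k)) y
                  + ereal (\<epsilon> k \<bullet> (y - x k)))
            (\<lambda>_. True) (x (Suc k))) \<and>
     (\<forall>k. norm (\<epsilon> k) \<le> \<mu>2 / 2 * reg_factor f g \<delta> (x k) * norm (x (Suc k) - x k))"

end

theory Submission
  imports Defs
begin

text \<open>Write \<open>d = x_{k+1} - x_k\<close> and \<open>w = H_k d + \<epsilon>_k\<close>. The optimality condition of the
  subproblem says that \<open>- (grad f x_k + w)\<close> is a subgradient of \<open>g\<close> at \<open>x_{k+1}\<close>, and \<open>norm w\<close> is at most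
  \<open>(M + L_H + c + 3/2) norm d\<close>. Monotonicity of the subdifferential, applied to this subgradient
  and to the one that defines the proximal point, bounds the residual by \<open>norm d + norm w\<close>, which
  is (a). The subgradient inequality at \<open>x_k\<close> together with the descent lemma for \<open>f\<close> gives (b),
  and summing (b) gives (d). By (b) the steps tend to 0, so \<open>w\<close> does too; closedness of the graph of
  the subdifferential makes every cluster point stationary, and a bounded sequence with vanishing
  steps has a connected cluster set.\<close>

section \<open>Convex lower semicontinuous functions\<close>

lemma proper_fun_ereal_real:
  assumes "proper_fun g" "x \<in> eff_dom g"
  shows "g x = ereal (real_of_ereal (g x))"
  using assms by (cases "g x") (auto simp: proper_fun_def eff_dom_def)

lemma proper_fun_le_ereal_iff:
  assumes "proper_fun g" "x \<in> eff_dom g"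
  shows "g x \<le> ereal r \<longleftrightarrow> real_of_ereal (g x) \<le> r"
  using assms by (cases "g x") (auto simp: proper_fun_def eff_dom_def)

text \<open>The endpoints t = 0 and t = 1, absent from \<open>convex_fun\<close>, are added so that
  convexity of the domain follows at once.\<close>

lemma convex_fun_real:
  assumes g: "proper_fun g" "convex_fun g" and xy: "x \<in> eff_dom g" "y \<in> eff_dom g"
    and t: "0 \<le> t" "t \<le> 1"
  shows "(1 - t) *\<^sub>R x + t *\<^sub>R y \<in> eff_dom g"
    and "real_of_ereal (g ((1 - t) *\<^sub>R x + t *\<^sub>R y))
      \<le> (1 - t) * real_of_ereal (g x) + t * real_of_ereal (g y)"
proof -
  let ?z = "(1 - t) *\<^sub>R x + t *\<^sub>R y"
  have *: "?z \<in> eff_dom g \<and> real_of_ereal (g ?z)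
      \<le> (1 - t) * real_of_ereal (g x) + t * real_of_ereal (g y)"
  proof (cases "t = 0 \<or> t = 1")
    case True
    then show ?thesis using xy by auto
  next
    case False
    then have "g ?z \<le> ereal (1 - t) * g x + ereal t * g y"
      using t g(2)[unfolded convex_fun_def, rule_format, of t x y] by simp
    also have "\<dots> = ereal ((1 - t) * real_of_ereal (g x) + t * real_of_ereal (g y))"
      by (subst proper_fun_ereal_real[OF g(1) xy(1)], subst proper_fun_ereal_real[OF g(1) xy(2)])
        simp
    finally have le: "g ?z \<le> ereal ((1 - t) * real_of_ereal (g x) + t * real_of_ereal (g y))" .
    then have "?z \<in> eff_dom g"
      by (auto simp: eff_dom_def)
    with le show ?thesis
      using proper_fun_le_ereal_iff[OF g(1)] by blast
  qed
  then show "?z \<in> eff_dom g" and "real_of_ereal (g ?z)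
      \<le> (1 - t) * real_of_ereal (g x) + t * real_of_ereal (g y)" by auto
qed

lemma convex_eff_dom:
  assumes "proper_fun g" "convex_fun g"
  shows "convex (eff_dom g)"
  using convex_fun_real(1)[OF assms] unfolding convex_alt by auto

text \<open>\<open>lsc_fun\<close> looks at the punctured filter \<open>at x\<close>, whereas a
  sequence may hit its limit. A strict lower bound a < g l also holds at l itself, so it extends to
  the full neighbourhood filter.\<close>

lemma lsc_fun_le_liminf:
  assumes "lsc_fun g" "u \<longlonglongrightarrow> l"
  shows "g l \<le> liminf (\<lambda>n. g (u n))"
  unfolding le_Liminf_iff
proof (intro allI impI)
  fix a assume a: "a < g l"
  then have "\<forall>\<^sub>F y in at l. a < g y"
    using assms(1) unfolding lsc_fun_def le_Liminf_iff by blast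
  with a have "\<forall>\<^sub>F y in nhds l. a < g y"
    by (simp add: eventually_nhds_conv_at)
  then show "\<forall>\<^sub>F n in sequentially. a < g (u n)"
    using assms(2) unfolding filterlim_iff by blast
qed

text \<open>Direct method: a minimizing sequence has a convergent subsequence, and lower
  semicontinuity passes to its limit. The continuous term s makes room for the quadratic in the
  proximal objective.\<close>

lemma lsc_attains_min_on_compact:
  fixes g :: "'a::heine_borel \<Rightarrow> ereal"
  assumes g: "lsc_fun g" and s: "continuous_on UNIV s" and K: "compact K" "K \<noteq> {}"
  shows "\<exists>p\<in>K. \<forall>y\<in>K. g p + ereal (s p) \<le> g y + ereal (s y)"
proof -
  let ?h = "\<lambda>y. g y + ereal (s y)"
  obtain v where v: "\<And>n. v n \<in> ?h ` K" "v \<longlonglongrightarrow> Inf (?h ` K)"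
    using Inf_as_limit[of "?h ` K"] K(2) by blast
  then have "\<forall>n. \<exists>y\<in>K. v n = ?h y"
    by blast
  then obtain u where u: "\<And>n. u n \<in> K" "\<And>n. v n = ?h (u n)"
    by metis
  obtain p r where p: "p \<in> K" "strict_mono r" "(u \<circ> r) \<longlonglongrightarrow> p"
    using K(1) u(1) unfolding compact_def by meson
  have "(\<lambda>n. ereal (s ((u \<circ> r) n))) \<longlonglongrightarrow> ereal (s p)"
    using p(3) by (auto simp: o_def intro!: continuous_on_tendsto_compose[OF s])
  \<comment> \<open>The liminf splits because the s part converges to a finite limit.\<close>
  then have "liminf (\<lambda>n. ereal (s ((u \<circ> r) n)) + g ((u \<circ> r) n))
      = ereal (s p) + liminf (\<lambda>n. g ((u \<circ> r) n))"
    by (rule ereal_liminf_lim_add) simp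
  moreover have "liminf (\<lambda>n. ereal (s ((u \<circ> r) n)) + g ((u \<circ> r) n)) = Inf (?h ` K)"
  proof (rule lim_imp_Liminf)
    show "(\<lambda>n. ereal (s ((u \<circ> r) n)) + g ((u \<circ> r) n)) \<longlonglongrightarrow> Inf (?h ` K)"
      using LIMSEQ_subseq_LIMSEQ[OF v(2) p(2)] by (simp add: o_def u(2) add.commute)
  qed simp
  ultimately have "?h p \<le> Inf (?h ` K)"
    using add_left_mono[OF lsc_fun_le_liminf[OF g p(3)], of "ereal (s p)"]
    by (simp add: add.commute)
  then show ?thesis
    using p(1) by (meson INF_lower order_trans)
qed

text \<open>A lower bound of linear growth, enough for coercivity of the proximal objective and
  obtained without separating hyperplanes. On the unit ball around z the minimum of g bounds it
  below; convexity along rays from z carries the bound outwards.\<close>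

lemma convex_lsc_conic_minorant:
  fixes g :: "'a::euclidean_space \<Rightarrow> ereal"
  assumes g: "proper_fun g" "lsc_fun g" "convex_fun g" and z: "z \<in> eff_dom g"
  shows "\<exists>a b. b \<ge> 0 \<and> (\<forall>y\<in>eff_dom g. a - b * norm (y - z) \<le> real_of_ereal (g y))"
proof -
  let ?G = "\<lambda>y. real_of_ereal (g y)"
  obtain w where w: "w \<in> cball z 1" "\<And>y. y \<in> cball z 1 \<Longrightarrow> g w \<le> g y"
    using lsc_attains_min_on_compact[OF g(2), of "\<lambda>_. 0" "cball z 1"] by auto
  have "g w \<le> g z" using w(2) by simp
  then have wD: "w \<in> eff_dom g" using z unfolding eff_dom_def by auto
  have real_le: "?G w \<le> ?G y" if "y \<in> cball z 1" "y \<in> eff_dom g" for y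
  proof -
    obtain r where "g y = ereal r"
      using proper_fun_ereal_real[OF g(1) \<open>y \<in> eff_dom g\<close>] by blast
    then show ?thesis
      using w(2)[OF \<open>y \<in> cball z 1\<close>] proper_fun_le_ereal_iff[OF g(1) wD] by simp
  qed
  define b where "b = ?G z - ?G w"
  have b: "b \<ge> 0" using real_le[of z] z by (simp add: b_def)
  have "?G w - b * norm (y - z) \<le> ?G y" if y: "y \<in> eff_dom g" for y
  proof (cases "norm (y - z) \<le> 1")
    case True
    then have "?G w \<le> ?G y"
      using y by (intro real_le) (auto simp: dist_norm norm_minus_commute)
    then show ?thesis using b by (smt (verit) mult_nonneg_nonneg norm_ge_zero)
  next
    case False
    define r where "r = norm (y - z)"
    have r: "r > 1" using False by (simp add: r_def)
    \<comment> \<open>The point where the segment from z to y leaves the unit ball.\<close>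
    let ?p = "(1 - 1 / r) *\<^sub>R z + (1 / r) *\<^sub>R y"
    have "?p - z = (1 / r) *\<^sub>R (y - z)" by (simp add: algebra_simps)
    then have "norm (?p - z) = (1 / r) * r" using r by (simp add: r_def[symmetric])
    then have "norm (?p - z) = 1" using r by simp
    then have "?p \<in> cball z 1" by (simp add: dist_norm norm_minus_commute)
    moreover have "?p \<in> eff_dom g" "?G ?p \<le> (1 - 1 / r) * ?G z + 1 / r * ?G y"
      using r by (intro convex_fun_real[OF g(1,3) z y]; simp)+
    ultimately have "?G w \<le> (1 - 1 / r) * ?G z + 1 / r * ?G y"
      using real_le by force
    then have "r * ?G w \<le> r * ((1 - 1 / r) * ?G z + 1 / r * ?G y)"
      using r by (intro mult_left_mono) auto
    also have "\<dots> = (r - 1) * ?G z + ?G y" using r by (simp add: field_simps)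
    finally have "?G z - b * r \<le> ?G y" by (simp add: b_def algebra_simps)
    then show ?thesis using b by (simp add: b_def r_def)
  qed
  then show ?thesis using b by blast
qed

text \<open>Since \<open>prox\<close> is defined by choice, it suffices that some minimizer exists.
  The quadratic outgrows the conic minorant, so values outside a large ball around z are no better
  than the value at z, and a minimizer over the ball is global.\<close>

lemma prox_is_arg_min:
  fixes g :: "'a::euclidean_space \<Rightarrow> ereal"
  assumes g: "proper_fun g" "lsc_fun g" "convex_fun g"
  shows "is_arg_min (\<lambda>y. g y + ereal (1/2 * (norm (y - u))\<^sup>2)) (\<lambda>_. True) (prox g u)"
proof -
  let ?h = "\<lambda>y. g y + ereal (1/2 * (norm (y - u))\<^sup>2)"
  let ?G = "\<lambda>y. real_of_ereal (g y)"
  obtain z where z: "z \<in> eff_dom g" using g(1) by (auto simp: proper_fun_def)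
  obtain a b where b: "b \<ge> 0" and ab: "\<And>y. y \<in> eff_dom g \<Longrightarrow> a - b * norm (y - z) \<le> ?G y"
    using convex_lsc_conic_minorant[OF g z] by blast
  define d where "d = norm (z - u)"
  define e where "e = \<bar>?G z - a\<bar>"
  \<comment> \<open>For s > R this gives s > 1, s > d and s / 2 - (d + b) > e + 1/2, the three facts
    used in \<open>far\<close>.\<close>
  define R where "R = 2 * (d + b) + 2 * e + 1"
  have d: "d \<ge> 0" by (simp add: d_def)
  have e: "0 \<le> e" "?G z - a \<le> e" by (simp_all add: e_def)
  have R: "R \<ge> 0" using b d e by (simp add: R_def)
  have far: "?h z \<le> ?h y" if y: "y \<notin> cball z R" for y
  proof (cases "y \<in> eff_dom g")
    case True
    define s where "s = norm (y - z)"
    have s: "s > R" using y by (simp add: s_def dist_norm norm_minus_commute)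
    have "?G z - a \<le> 1 * (e + 1/2)" using e by simp
    also have "\<dots> \<le> s * (e + 1/2)"
      using s b d e unfolding R_def by (intro mult_right_mono) auto
    also have "\<dots> \<le> s * (s / 2 - (d + b))"
      using s by (intro mult_left_mono) (use s b d e in \<open>auto simp: R_def\<close>)
    finally have 1: "?G z - a \<le> s * (s / 2 - (d + b))" .
    have "s - d \<le> norm (y - u)"
      using norm_triangle_ineq2[of "y - z" "u - z"] by (simp add: s_def d_def norm_minus_commute)
    moreover have "0 \<le> s - d" using s b d e by (auto simp: R_def)
    ultimately have "(s - d)\<^sup>2 \<le> (norm (y - u))\<^sup>2" by (intro power_mono)
    with 1 ab[OF True] have "?G z + 1/2 * d\<^sup>2 \<le> ?G y + 1/2 * (norm (y - u))\<^sup>2"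
      unfolding s_def[symmetric] by (simp add: power2_eq_square algebra_simps)
    then show ?thesis
      by (subst proper_fun_ereal_real[OF g(1) z], subst proper_fun_ereal_real[OF g(1) True])
        (simp add: d_def)
  qed (auto simp: eff_dom_def)
  have "continuous_on UNIV (\<lambda>y. 1/2 * (norm (y - u))\<^sup>2)"
    by (intro continuous_intros)
  then obtain p where p: "\<And>y. y \<in> cball z R \<Longrightarrow> ?h p \<le> ?h y"
    using lsc_attains_min_on_compact[OF g(2), of _ "cball z R"] R by fastforce
  have "?h p \<le> ?h y" for y
    using p[of y] p[of z] far[of y] R by (cases "y \<in> cball z R") (auto intro: order_trans)
  then have "is_arg_min ?h (\<lambda>_. True) p"
    by (auto simp: is_arg_min_def not_less)
  then show ?thesis
    unfolding prox_def arg_min_def by (rule someI)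
qed

section \<open>Subdifferentials: optimality, monotonicity, closed graph\<close>

lemma subdifferential_real_iff:
  assumes g: "proper_fun g"
  shows "v \<in> subdifferential g p \<longleftrightarrow> p \<in> eff_dom g \<and>
    (\<forall>y\<in>eff_dom g. real_of_ereal (g p) + v \<bullet> (y - p) \<le> real_of_ereal (g y))"
proof (cases "p \<in> eff_dom g")
  case True
  obtain r where r: "g p = ereal r" using proper_fun_ereal_real[OF g True] by blast
  have "g p + ereal (v \<bullet> (y - p)) \<le> g y \<longleftrightarrow>
      (y \<in> eff_dom g \<longrightarrow> real_of_ereal (g p) + v \<bullet> (y - p) \<le> real_of_ereal (g y))" for y
    using g r by (cases "g y") (auto simp: eff_dom_def proper_fun_def)
  then show ?thesis using True r by (auto simp: subdifferential_def)
next
  case False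
  then show ?thesis by (auto simp: subdifferential_def eff_dom_def)
qed

text \<open>Fermat's rule for g plus a quadratic, replacing a sum rule for subdifferentials. The
  vector b is the gradient of s at p, and C collects the second-order part. It serves both the
  proximal point and the Newton subproblem.\<close>

lemma subdifferential_of_minimizer:
  assumes g: "proper_fun g" "convex_fun g"
    and p: "is_arg_min (\<lambda>y. g y + ereal (s y)) (\<lambda>_. True) p"
    and s: "\<And>t y. s (p + t *\<^sub>R (y - p)) = s p + t * (b \<bullet> (y - p)) + t\<^sup>2 * C y"
  shows "- b \<in> subdifferential g p"
proof -
  let ?G = "\<lambda>y. real_of_ereal (g y)"
  have min: "g p + ereal (s p) \<le> g y + ereal (s y)" for y
    using p by (auto simp: is_arg_min_def not_less)
  obtain z where "z \<in> eff_dom g" using g(1) by (auto simp: proper_fun_def)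
  with min[of z] have pD: "p \<in> eff_dom g"
    by (auto simp: eff_dom_def)
  have "?G p + - b \<bullet> (y - p) \<le> ?G y" if y: "y \<in> eff_dom g" for y
  proof -
    let ?A = "?G y - ?G p + b \<bullet> (y - p)"
    \<comment> \<open>Compare p with a nearby point of the segment towards y, use convexity of g,
      and divide by t. Letting t decrease to 0 then removes the second-order term.\<close>
    have "0 \<le> ?A + t * C y" if t: "0 < t" "t < 1" for t
    proof -
      let ?q = "(1 - t) *\<^sub>R p + t *\<^sub>R y"
      have qD: "?q \<in> eff_dom g" and q: "?G ?q \<le> (1 - t) * ?G p + t * ?G y"
        using t by (intro convex_fun_real[OF g pD y]; simp)+
      have "?q = p + t *\<^sub>R (y - p)" by (simp add: algebra_simps)
      then have sq: "s ?q = s p + t * (b \<bullet> (y - p)) + t\<^sup>2 * C y" using s by simp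
      obtain a a' where a: "g p = ereal a" "g ?q = ereal a'"
        using proper_fun_ereal_real[OF g(1) pD] proper_fun_ereal_real[OF g(1) qD] by blast
      then have "?G p + s p \<le> ?G ?q + s ?q"
        using min[of ?q] by simp
      with q sq have "0 \<le> t * (?A + t * C y)"
        by (simp add: power2_eq_square algebra_simps)
      then show ?thesis using t by (simp add: zero_le_mult_iff)
    qed
    moreover have "((\<lambda>t. ?A + t * C y) \<longlongrightarrow> ?A + 0 * C y) (at_right 0)"
      by (intro tendsto_intros)
    ultimately have "0 \<le> ?A + 0 * C y"
      by (intro tendsto_lowerbound[of _ _ "at_right (0::real)"])
        (auto simp: eventually_at_right_field intro!: exI[of _ 1])
    then show ?thesis by simp
  qed
  with pD show ?thesis by (simp add: subdifferential_real_iff[OF g(1)])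
qed

lemma prox_subgradient:
  fixes g :: "'a::euclidean_space \<Rightarrow> ereal"
  assumes g: "proper_fun g" "lsc_fun g" "convex_fun g"
  shows "u - prox g u \<in> subdifferential g (prox g u)"
proof -
  have "- (prox g u - u) \<in> subdifferential g (prox g u)"
    by (rule subdifferential_of_minimizer[OF g(1,3) prox_is_arg_min[OF g, of u],
          where C = "\<lambda>y. 1/2 * ((y - prox g u) \<bullet> (y - prox g u))"])
      (simp only: power2_norm_eq_inner, simp add: power2_eq_square inner_commute algebra_simps)
  then show ?thesis by simp
qed

lemma subdifferential_monotone:
  assumes "proper_fun g" "v \<in> subdifferential g p" "w \<in> subdifferential g q"
  shows "0 \<le> (v - w) \<bullet> (p - q)"
proof -
  have "real_of_ereal (g p) + v \<bullet> (q - p) \<le> real_of_ereal (g q)"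
    "real_of_ereal (g q) + w \<bullet> (p - q) \<le> real_of_ereal (g p)"
    using assms by (auto simp: subdifferential_real_iff)
  then show ?thesis by (simp add: algebra_simps)
qed

lemma subdifferential_closed_graph:
  assumes g: "proper_fun g" "lsc_fun g"
    and u: "u \<longlonglongrightarrow> l" and v: "v \<longlonglongrightarrow> w" and sub: "\<And>n. v n \<in> subdifferential g (u n)"
  shows "w \<in> subdifferential g l"
proof -
  have le: "g l \<le> ereal (real_of_ereal (g y) - w \<bullet> (y - l))" if y: "y \<in> eff_dom g" for y
  proof -
    have "g l \<le> liminf (\<lambda>n. g (u n))" by (rule lsc_fun_le_liminf[OF g(2) u])
    also have "\<dots> \<le> liminf (\<lambda>n. ereal (real_of_ereal (g y) - v n \<bullet> (y - u n)))"
    proof (intro Liminf_mono always_eventually allI)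
      fix n
      have "u n \<in> eff_dom g" "real_of_ereal (g (u n)) + v n \<bullet> (y - u n) \<le> real_of_ereal (g y)"
        using sub[of n] y by (auto simp: subdifferential_real_iff[OF g(1)])
      then show "g (u n) \<le> ereal (real_of_ereal (g y) - v n \<bullet> (y - u n))"
        by (auto simp: proper_fun_le_ereal_iff[OF g(1)])
    qed
    also have "\<dots> = ereal (real_of_ereal (g y) - w \<bullet> (y - l))"
      by (intro lim_imp_Liminf tendsto_intros u v) simp
    finally show ?thesis .
  qed
  \<comment> \<open>Finiteness of g at the limit is not given in advance; the bound
    \<open>le\<close> at one point of the domain supplies it.\<close>
  obtain z where "z \<in> eff_dom g" using g(1) by (auto simp: proper_fun_def)
  from le[OF this] have l: "l \<in> eff_dom g" by (auto simp: eff_dom_def)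
  have "real_of_ereal (g l) + w \<bullet> (y - l) \<le> real_of_ereal (g y)" if "y \<in> eff_dom g" for y
    using le[OF that] by (simp add: proper_fun_le_ereal_iff[OF g(1) l])
  with l show ?thesis by (simp add: subdifferential_real_iff[OF g(1)])
qed

text \<open>Monotonicity of an auxiliary function replaces integration of the gradient:
  \<open>\<psi>\<close> is F along the segment minus the linear and quadratic terms of the bound,
  and the Lipschitz condition makes its derivative nonpositive.\<close>

lemma descent_lemma:
  fixes F :: "'a::real_inner \<Rightarrow> real"
  assumes seg: "closed_segment p q \<subseteq> S"
    and der: "\<And>z. z \<in> S \<Longrightarrow> GDERIV F z :> G z" and lip: "L-lipschitz_on S G"
  shows "F q \<le> F p + G p \<bullet> (q - p) + L / 2 * (norm (q - p))\<^sup>2"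
proof -
  define d where "d = q - p"
  define \<psi> where "\<psi> t = F (p + t *\<^sub>R d) - t * (G p \<bullet> d) - L / 2 * t\<^sup>2 * (norm d)\<^sup>2" for t
  have "\<psi> 1 \<le> \<psi> 0"
  proof (rule DERIV_nonpos_imp_nonincreasing, simp)
    fix t :: real assume t: "0 \<le> t" "t \<le> 1"
    have inS: "p + r *\<^sub>R d \<in> S" if "0 \<le> r" "r \<le> 1" for r
    proof -
      have "p + r *\<^sub>R d = (1 - r) *\<^sub>R p + r *\<^sub>R q" by (simp add: d_def algebra_simps)
      then show ?thesis using that seg by (auto simp: closed_segment_def)
    qed
    have "(F has_derivative (\<lambda>h. h \<bullet> G (p + t *\<^sub>R d))) (at (p + t *\<^sub>R d))"
      using der[OF inS[OF t]] by (simp add: gderiv_def)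
    moreover have "((\<lambda>t. p + t *\<^sub>R d) has_derivative (\<lambda>h. h *\<^sub>R d)) (at t)"
      by (auto intro!: derivative_eq_intros)
    ultimately have "((\<lambda>t. F (p + t *\<^sub>R d)) has_derivative (\<lambda>h. (h *\<^sub>R d) \<bullet> G (p + t *\<^sub>R d))) (at t)"
      using has_derivative_compose[of "\<lambda>t. p + t *\<^sub>R d" _ t UNIV F] by blast
    then have DF: "((\<lambda>t. F (p + t *\<^sub>R d)) has_real_derivative d \<bullet> G (p + t *\<^sub>R d)) (at t)"
      by (rule has_derivative_imp_has_field_derivative) simp
    have D: "(\<psi> has_real_derivative
        d \<bullet> G (p + t *\<^sub>R d) - G p \<bullet> d - L * t * (norm d)\<^sup>2) (at t)"
      unfolding \<psi>_def by (rule derivative_eq_intros DF refl | simp)+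
    have "d \<bullet> G (p + t *\<^sub>R d) - G p \<bullet> d = d \<bullet> (G (p + t *\<^sub>R d) - G p)"
      by (simp add: inner_diff_right inner_commute)
    also have "\<dots> \<le> norm d * norm (G (p + t *\<^sub>R d) - G p)"
      by (rule norm_cauchy_schwarz)
    also have "\<dots> \<le> norm d * (L * norm (t *\<^sub>R d))"
      using lipschitz_onD[OF lip inS[OF t] inS[of 0]] by (intro mult_left_mono) (auto simp: dist_norm)
    finally have "d \<bullet> G (p + t *\<^sub>R d) - G p \<bullet> d - L * t * (norm d)\<^sup>2 \<le> 0"
      using t by (simp add: power2_eq_square algebra_simps)
    with D show "\<exists>y. (\<psi> has_real_derivative y) (at t) \<and> y \<le> 0" by blast
  qed
  then show ?thesis by (simp add: \<psi>_def d_def algebra_simps)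
qed

section \<open>Cluster points\<close>

text \<open>This exhibits the cluster set as an intersection of closed sets, which yields its
  closedness.\<close>

lemma cluster_points_iff_closure:
  fixes x :: "nat \<Rightarrow> 'a::metric_space"
  shows "l \<in> cluster_points x \<longleftrightarrow> (\<forall>n. l \<in> closure (x ` {n..}))"
proof
  assume "l \<in> cluster_points x"
  then obtain r :: "nat \<Rightarrow> nat" where r: "strict_mono r" "(x \<circ> r) \<longlonglongrightarrow> l"
    by (auto simp: cluster_points_def)
  show "\<forall>n. l \<in> closure (x ` {n..})"
  proof
    fix n
    have "(x \<circ> r) (i + n) \<in> x ` {n..}" for i
      using seq_suble[OF r(1), of "i + n"] by auto
    then show "l \<in> closure (x ` {n..})"
      unfolding closure_sequential using LIMSEQ_ignore_initial_segment[OF r(2), of n]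
      by (intro CollectI exI[of _ "\<lambda>i. (x \<circ> r) (i + n)"]) auto
  qed
next
  assume l: "\<forall>n. l \<in> closure (x ` {n..})"
  have ex: "\<exists>m\<ge>n. dist (x m) l < e" if "e > 0" for n e
    using l that unfolding closure_approachable by force
  \<comment> \<open>Closeness to l and growth of the index are secured together, each index being
    chosen beyond the previous one.\<close>
  have "\<exists>r. \<forall>n. dist (x (r n)) l < 1 / Suc n \<and> r n < r (Suc n)"
  proof (rule dependent_nat_choice)
    show "\<exists>m. dist (x m) l < 1 / Suc 0" using ex[of 1 0] by auto
    show "\<exists>m'. dist (x m') l < 1 / Suc (Suc n) \<and> m < m'" for m n
      using ex[of "1 / Suc (Suc n)" "Suc m"] by (auto simp: Suc_le_eq)
  qed
  then obtain r where r: "\<And>n. dist (x (r n)) l < 1 / Suc n" "\<And>n. r n < r (Suc n)"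
    by blast
  have "(\<lambda>n. dist (x (r n)) l) \<longlonglongrightarrow> 0"
  proof (rule tendsto_sandwich[OF _ _ tendsto_const])
    show "(\<lambda>n. 1 / real (Suc n)) \<longlonglongrightarrow> 0" using LIMSEQ_inverse_real_of_nat by (simp add: field_simps)
    show "\<forall>\<^sub>F n in sequentially. dist (x (r n)) l \<le> 1 / real (Suc n)"
      using r(1) by (simp add: less_imp_le)
  qed simp
  then have "(x \<circ> r) \<longlonglongrightarrow> l" by (subst tendsto_dist_iff) (simp add: o_def)
  with r(2) show "l \<in> cluster_points x"
    by (auto simp: cluster_points_def strict_mono_Suc_iff)
qed

lemma closed_cluster_points:
  fixes x :: "nat \<Rightarrow> 'a::metric_space"
  shows "closed (cluster_points x)"
proof -
  have "cluster_points x = (\<Inter>n. closure (x ` {n..}))"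
    by (auto simp: cluster_points_iff_closure)
  then show ?thesis by auto
qed

lemma cluster_points_nonempty:
  fixes x :: "nat \<Rightarrow> 'a::heine_borel"
  assumes "bounded (range x)"
  shows "cluster_points x \<noteq> {}"
  using bounded_imp_convergent_subsequence[OF assms] by (auto simp: cluster_points_def)

lemma tendsto_Suc_subseq:
  fixes x :: "nat \<Rightarrow> 'a::real_normed_vector"
  assumes "(\<lambda>k. x (Suc k) - x k) \<longlonglongrightarrow> 0" "strict_mono r" "(\<lambda>j. x (r j)) \<longlonglongrightarrow> l"
  shows "(\<lambda>j. x (Suc (r j))) \<longlonglongrightarrow> l"
  using tendsto_add[OF assms(3) LIMSEQ_subseq_LIMSEQ[OF assms(1,2)]] by (simp add: o_def)

text \<open>If the cluster set split into closed parts \<open>A\<close> and \<open>B\<close>, the iterates would cross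
  the zero level of \<open>infdist z A - infdist z B\<close> infinitely often, and as the steps vanish they
  would accumulate on that level, which meets neither part.\<close>

lemma connected_cluster_points:
  fixes x :: "nat \<Rightarrow> 'a::euclidean_space"
  assumes bdd: "bounded (range x)" and step: "(\<lambda>k. x (Suc k) - x k) \<longlonglongrightarrow> 0"
  shows "connected (cluster_points x)"
proof (rule ccontr)
  assume "\<not> connected (cluster_points x)"
  then obtain A B where AB: "closed A" "closed B" "A \<noteq> {}" "B \<noteq> {}" "A \<union> B = cluster_points x"
    "A \<inter> B = {}"
    unfolding connected_closed_set[OF closed_cluster_points] by blast
  define h where "h z = infdist z A - infdist z B" for z
  have h_lim: "((\<lambda>n. h (y n)) \<longlongrightarrow> h l) sequentially" if "y \<longlonglongrightarrow> l" for y l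
    unfolding h_def by (intro tendsto_intros that)
  have hA: "h z < 0" if "z \<in> A" for z
  proof -
    have "z \<notin> B" using that AB by auto
    then show ?thesis
      using in_closed_iff_infdist_zero[OF AB(2,4), of z] that infdist_nonneg[of z B]
      by (simp add: h_def)
  qed
  have hB: "h z > 0" if "z \<in> B" for z
  proof -
    have "z \<notin> A" using that AB by auto
    then show ?thesis
      using in_closed_iff_infdist_zero[OF AB(1,3), of z] that infdist_nonneg[of z A]
      by (simp add: h_def)
  qed
  have freq: "\<exists>m\<ge>n. P (h (x m))" if "l \<in> cluster_points x" "open {t. P t}" "P (h l)" for l n P
  proof -
    obtain r :: "nat \<Rightarrow> nat" where r: "strict_mono r" "(x \<circ> r) \<longlonglongrightarrow> l"
      using \<open>l \<in> cluster_points x\<close> by (auto simp: cluster_points_def)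
    have "\<forall>\<^sub>F j in sequentially. (h ((x \<circ> r) j)) \<in> {t. P t}"
      using topological_tendstoD[OF h_lim[OF r(2)] that(2)] that(3) by simp
    then obtain N where "\<And>j. j \<ge> N \<Longrightarrow> P (h (x (r j)))"
      unfolding eventually_sequentially by auto
    then show ?thesis
      using seq_suble[OF r(1)] by (meson le_trans nat_le_linear)
  qed
  obtain a b where ab: "a \<in> A" "b \<in> B" using AB by auto
  \<comment> \<open>The iterates come near both a and b arbitrarily late. Without an upward crossing
    after n, a negative value at i would propagate by induction to every later index.\<close>
  have cross: "\<exists>m\<ge>n. h (x m) \<le> 0 \<and> 0 < h (x (Suc m))" for n
  proof (rule ccontr)
    assume no: "\<not> ?thesis"
    obtain i where i: "i \<ge> n" "h (x i) < 0"
      using freq[of a "\<lambda>t. t < 0" n] ab(1) hA AB(5) by (auto simp: open_Collect_less)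
    obtain j where j: "j \<ge> i" "h (x j) > 0"
      using freq[of b "\<lambda>t. t > 0" i] ab(2) hB AB(5) by (auto simp: open_Collect_less)
    have "h (x j) \<le> 0" using j(1)
    proof (induction j rule: dec_induct)
      case base then show ?case using i by simp
    next
      case (step m)
      then show ?case using no i(1) by (meson le_trans not_less)
    qed
    with j show False by simp
  qed
  then have "\<not> (\<forall>\<^sub>F m in sequentially. \<not> (h (x m) \<le> 0 \<and> 0 < h (x (Suc m))))"
    unfolding eventually_sequentially by blast
  then obtain r :: "nat \<Rightarrow> nat" where r: "strict_mono r"
    "\<And>j. h (x (r j)) \<le> 0" "\<And>j. 0 < h (x (Suc (r j)))"
    using not_eventually_sequentiallyD by blast
  have "bounded (range (x \<circ> r))"
    using bdd by (rule bounded_subset) auto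
  then obtain l s where s: "strict_mono s" "((x \<circ> r) \<circ> s) \<longlonglongrightarrow> l"
    using bounded_imp_convergent_subsequence by blast
  have rs: "strict_mono (r \<circ> s)" "(\<lambda>j. x ((r \<circ> s) j)) \<longlonglongrightarrow> l"
    using strict_mono_o[OF r(1) s(1)] s(2) by (simp_all add: o_def)
  then have "l \<in> A \<union> B" unfolding AB(5) cluster_points_def by (auto simp: o_def)
  \<comment> \<open>The two sides of the crossings, at m and \<open>Suc m\<close>, have the same
    limit l because the steps vanish; hence h l = 0.\<close>
  moreover have "h l \<le> 0"
    using h_lim[OF rs(2)] r(2) by (intro LIMSEQ_le_const2) auto
  moreover have "0 \<le> h l"
    using h_lim[OF tendsto_Suc_subseq[OF step rs]] r(3)
    by (intro LIMSEQ_le_const) (auto intro: less_imp_le)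
  ultimately show False using hA[of l] hB[of l] by auto
qed

section \<open>The inexact proximal Newton step\<close>

lemma symmetric_matrix_inner:
  fixes H :: "real^'n^'n"
  assumes "transpose H = H"
  shows "u \<bullet> (H *v v) = v \<bullet> (H *v u)"
  using assms by (metis dot_lmul_matrix inner_commute transpose_matrix_vector)

lemma model_matrix_vector_mult:
  "model_matrix f g L c \<mu> \<delta> B x *v u = B *v u + (L + c + \<mu> * reg_factor f g \<delta> x) *\<^sub>R u"
  by (simp add: model_matrix_def matrix_vector_mult_add_rdistrib flip: scaleR_matrix_vector_assoc)

lemma transpose_model_matrix:
  "transpose B = B \<Longrightarrow> transpose (model_matrix f g L c \<mu> \<delta> B x) = model_matrix f g L c \<mu> \<delta> B x"
  by (auto simp: model_matrix_def transpose_def mat_def vec_eq_iff)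

lemma reg_factor_bounds: "0 \<le> reg_factor f g \<delta> x" "reg_factor f g \<delta> x \<le> 1"
  by (auto simp: reg_factor_def rpow_def)

text \<open>Finiteness of f z lets everything except g be gathered into one real quadratic s.
  Symmetry of H merges the two cross terms of its expansion at p.\<close>

lemma quad_model_minimizer_subgradient:
  fixes f g :: "real^'n \<Rightarrow> ereal"
  assumes g: "proper_fun g" "convex_fun g" and fz: "\<bar>f z\<bar> \<noteq> \<infinity>" and H: "transpose H = H"
    and p: "is_arg_min (\<lambda>y. quad_model f g z H y + ereal (e \<bullet> (y - z))) (\<lambda>_. True) p"
  shows "- (grad f z + (H *v (p - z) + e)) \<in> subdifferential g p"
proof -
  obtain \<alpha> where \<alpha>: "f z = ereal \<alpha>" using fz by auto
  define s where "s y = \<alpha> + grad f z \<bullet> (y - z) + 1/2 * ((y - z) \<bullet> (H *v (y - z))) + e \<bullet> (y - z)" for y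
  have "quad_model f g z H y + ereal (e \<bullet> (y - z)) = g y + ereal (s y)" for y
    by (cases "g y") (auto simp: quad_model_def \<alpha> s_def)
  with p have p': "is_arg_min (\<lambda>y. g y + ereal (s y)) (\<lambda>_. True) p" by simp
  have "s (p + t *\<^sub>R (y - p)) = s p + t * ((grad f z + (H *v (p - z) + e)) \<bullet> (y - p))
      + t\<^sup>2 * (1/2 * ((y - p) \<bullet> (H *v (y - p))))" for t y
  proof -
    define a b where "a = p - z" and "b = y - p"
    have split: "p + t *\<^sub>R b - z = a + t *\<^sub>R b" by (simp add: a_def)
    have Hab: "a \<bullet> (H *v b) = b \<bullet> (H *v a)" by (rule symmetric_matrix_inner[OF H])
    show ?thesis
      unfolding s_def b_def[symmetric] split a_def[symmetric]
      by (simp add: Hab matrix_vector_mult_scaleR inner_commute[of "H *v a" b]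
          matrix_vector_right_distrib inner_add_left inner_add_right power2_eq_square field_simps)
  qed
  then show ?thesis by (rule subdifferential_of_minimizer[OF g p'])
qed

text \<open>With r the residual and d = p - z, monotonicity at the two subgradients reads (r + d)
  \<bullet> (r + w) \<le> 0.\<close>

lemma kkt_residual_le:
  fixes f g :: "real^'n \<Rightarrow> ereal"
  assumes g: "proper_fun g" "lsc_fun g" "convex_fun g"
    and sub: "- (grad f z + w) \<in> subdifferential g p"
  shows "norm (kkt_residual f g z) \<le> norm (p - z) + norm w"
proof -
  define q where "q = prox g (z - grad f z)"
  define r d where "r = z - q" and "d = p - z"
  have "0 \<le> (((z - grad f z) - q) - (- (grad f z + w))) \<bullet> (q - p)"
    unfolding q_def by (rule subdifferential_monotone[OF g(1) prox_subgradient[OF g] sub])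
  also have "((z - grad f z) - q) - (- (grad f z + w)) = r + w" by (simp add: r_def)
  also have "q - p = - r - d" by (simp add: r_def d_def)
  finally have mono: "r \<bullet> r \<le> - (r \<bullet> d) - r \<bullet> w - w \<bullet> d"
    by (simp add: inner_diff_right inner_add_left inner_commute[of w r])
  \<comment> \<open>Completing the square: r lies in the ball having the segment from - d to - w as
    a diameter.\<close>
  have "(norm (r + (1/2) *\<^sub>R (d + w)))\<^sup>2 \<le> (1/2 * norm (w - d))\<^sup>2"
    using mono unfolding power_mult_distrib power2_norm_eq_inner
    by (simp add: inner_commute algebra_simps power2_eq_square)
  then have "norm (r + (1/2) *\<^sub>R (d + w)) \<le> 1/2 * norm (w - d)"
    by (rule power2_le_imp_le) simp
  moreover have "norm r \<le> norm (r + (1/2) *\<^sub>R (d + w)) + 1/2 * norm (d + w)"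
    using norm_triangle_ineq4[of "r + (1/2) *\<^sub>R (d + w)" "(1/2) *\<^sub>R (d + w)"] by simp
  ultimately have "norm r \<le> norm d + norm w"
    using norm_triangle_ineq4[of w d] norm_triangle_ineq[of d w] by linarith
  then show ?thesis by (simp add: kkt_residual_def r_def d_def q_def)
qed

theorem theorem3:
  fixes f g :: "real^'n \<Rightarrow> ereal"
    and \<Omega>1 :: "(real^'n) set"
    and L_H c \<mu>1 \<mu>2 \<delta> M :: real
    and B :: "nat \<Rightarrow> real^'n^'n"
    and \<epsilon> x :: "nat \<Rightarrow> real^'n"
  assumes sol: "solution_set f g \<noteq> {}"
    and f_val: "\<And>z. f z \<noteq> -\<infinity>"
    and open_dom: "open \<Omega>1" "eff_dom g \<subseteq> \<Omega>1"
    and f_C2: "twice_cont_diff_on f \<Omega>1"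
    and f_Lip: "L_H-lipschitz_on \<Omega>1 (grad f)"
    and g_proper: "proper_fun g"
    and g_lsc: "lsc_fun g"
    and g_convex: "convex_fun g"
    and level: "\<And>z. z \<in> eff_dom g \<Longrightarrow> bounded {y. obj f g y \<le> obj f g z}"
    and c: "c > 0"
    and mu1: "0 < \<mu>1" "\<mu>1 \<le> 1"
    and mu2: "0 < \<mu>2" "\<mu>2 \<le> \<mu>1"
    and delta: "0 \<le> \<delta>" "\<delta> \<le> 1"
    and M: "M \<ge> 0"
    and start: "x 0 \<in> eff_dom g"
    and alg: "inexact_prox_newton f g L_H c \<mu>1 \<mu>2 \<delta> M B \<epsilon> x"
  defines "\<eta> \<equiv> M + L_H + c + 3"
  defines "\<zeta> \<equiv> 2 * \<eta>\<^sup>2 / c"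
  shows "(\<forall>k. norm (kkt_residual f g (x k)) \<le> \<eta> * norm (x (Suc k) - x k)) \<and>
    (\<forall>k. obj f g (x k) - obj f g (x (Suc k)) \<ge> ereal (c / 2 * (norm (x (Suc k) - x k))\<^sup>2)) \<and>
    (cluster_points x \<subseteq> stationary_points f g \<and> cluster_points x \<noteq> {} \<and>
       closed (cluster_points x) \<and> connected (cluster_points x)) \<and>
    (\<forall>k. Min ((\<lambda>j. norm (kkt_residual f g (x j))) ` {0..k})
       \<le> sqrt (\<zeta> * real_of_ereal (obj f g (x 0) - opt_val f g)) / sqrt (real (k + 1)))"
proof -
  let ?D = "eff_dom g"
  define F G where "F y = real_of_ereal (f y)" and "G y = real_of_ereal (g y)" for y
  define \<phi> where "\<phi> y = F y + G y" for y
  define d r where "d k = x (Suc k) - x k" and "r k = reg_factor f g \<delta> (x k)" for k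
  define H where "H k = model_matrix f g L_H c \<mu>1 \<delta> (B k) (x k)" for k
  define w where "w k = H k *v d k + \<epsilon> k" for k
  define res where "res k = norm (kkt_residual f g (x k))" for k
  have L: "0 \<le> L_H" using f_Lip by (rule lipschitz_on_nonneg)
  have fin: "\<bar>f y\<bar> \<noteq> \<infinity>" if "y \<in> ?D" for y
  proof -
    have "y \<in> \<Omega>1" using that open_dom(2) by blast
    with f_C2 show ?thesis by (simp add: twice_cont_diff_on_def)
  qed
  have obj: "obj f g y = ereal (\<phi> y)" if y: "y \<in> ?D" for y
    using fin[OF y] proper_fun_ereal_real[OF g_proper y]
    by (cases "f y"; cases "g y") (auto simp: obj_def \<phi>_def F_def G_def)
  have der: "GDERIV F y :> grad f y" "isCont (grad f) y" if "y \<in> \<Omega>1" for y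
    using that f_C2 by (auto simp: twice_cont_diff_on_def F_def[abs_def] intro: has_derivative_continuous)
  have B: "transpose (B k) = B k" "\<And>v. 0 \<le> v \<bullet> (B k *v v)" "spectral_norm (B k) \<le> M" for k
    using alg by (auto simp: inexact_prox_newton_def sym_psd_def)
  have \<epsilon>: "norm (\<epsilon> k) \<le> \<mu>2 / 2 * r k * norm (d k)" for k
    using alg by (auto simp: inexact_prox_newton_def r_def d_def)
  have r: "0 \<le> r k" "r k \<le> 1" for k
    unfolding r_def by (rule reg_factor_bounds)+
  have H: "H k *v v = B k *v v + (L_H + c + \<mu>1 * r k) *\<^sub>R v" for k v
    unfolding H_def r_def by (rule model_matrix_vector_mult)

  \<comment> \<open>Optimality of the subproblem and feasibility of the iterates\<close>
  have sub_step: "- (grad f (x k) + w k) \<in> subdifferential g (x (Suc k))" if "x k \<in> ?D" for k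
  proof -
    have "transpose (H k) = H k"
      unfolding H_def by (rule transpose_model_matrix[OF B(1)])
    moreover have "is_arg_min (\<lambda>y. quad_model f g (x k) (H k) y + ereal (\<epsilon> k \<bullet> (y - x k)))
        (\<lambda>_. True) (x (Suc k))"
      using alg by (simp add: inexact_prox_newton_def H_def)
    ultimately show ?thesis
      unfolding w_def d_def
      using fin[OF that] by (intro quad_model_minimizer_subgradient[OF g_proper g_convex])
  qed
  \<comment> \<open>\<open>sub_step\<close> needs f finite at the current iterate and places the
    next one in the domain of g, so induction removes its premise.\<close>
  have xD: "x k \<in> ?D" for k
  proof (induction k)
    case (Suc k)
    from sub_step[OF this] show ?case by (simp add: subdifferential_real_iff[OF g_proper])
  qed (rule start)
  note sub = sub_step[OF xD]

  \<comment> \<open>Residual bound (a)\<close>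
  have \<mu>2_r: "\<mu>2 / 2 * r k \<le> 1/2" for k
    using mult_mono[of \<mu>2 1 "r k" 1] r[of k] mu1 mu2 by simp
  \<comment> \<open>In 3/2, the 1 bounds the regularization \<open>\<mu>1 * r k\<close> and the 1/2
    bounds the inexactness. The extra \<open>norm (d k)\<close> in (a) makes 5/2, within the 3 of
    \<open>\<eta>\<close>.\<close>
  have norm_w: "norm (w k) \<le> (M + L_H + c + 3/2) * norm (d k)" for k
  proof -
    have "norm (B k *v d k) \<le> spectral_norm (B k) * norm (d k)"
      unfolding spectral_norm_def by (intro onorm matrix_vector_mul_bounded_linear)
    also have "\<dots> \<le> M * norm (d k)"
      using B(3) by (intro mult_right_mono) auto
    finally have 1: "norm (B k *v d k) \<le> M * norm (d k)" .
    have "\<mu>1 * r k \<le> 1"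
      using mult_mono[of \<mu>1 1 "r k" 1] r[of k] mu1 by simp
    then have "(L_H + c + \<mu>1 * r k) * norm (d k) \<le> (L_H + c + 1) * norm (d k)"
      by (intro mult_right_mono) auto
    moreover have "norm ((L_H + c + \<mu>1 * r k) *\<^sub>R d k) = (L_H + c + \<mu>1 * r k) * norm (d k)"
      using L c mu1 r[of k] by simp
    ultimately have 2: "norm ((L_H + c + \<mu>1 * r k) *\<^sub>R d k) \<le> (L_H + c + 1) * norm (d k)"
      by argo
    have 3: "norm (\<epsilon> k) \<le> 1/2 * norm (d k)"
      using \<epsilon>[of k] mult_right_mono[OF \<mu>2_r norm_ge_zero] by (rule order_trans)
    have "norm (w k) \<le> norm (B k *v d k) + norm ((L_H + c + \<mu>1 * r k) *\<^sub>R d k) + norm (\<epsilon> k)"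
      unfolding w_def H by (intro norm_triangle_le add_right_mono norm_triangle_ineq)
    also have "\<dots> \<le> M * norm (d k) + (L_H + c + 1) * norm (d k) + 1/2 * norm (d k)"
      by (intro add_mono 1 2 3)
    finally show ?thesis by (simp add: algebra_simps)
  qed
  have a: "res k \<le> \<eta> * norm (d k)" for k
  proof -
    have "res k \<le> norm (d k) + norm (w k)"
      unfolding res_def d_def by (rule kkt_residual_le[OF g_proper g_lsc g_convex sub])
    also have "\<dots> \<le> norm (d k) + (M + L_H + c + 3/2) * norm (d k)"
      by (intro add_left_mono norm_w)
    also have "\<dots> = (M + L_H + c + 5/2) * norm (d k)"
      by (simp add: algebra_simps)
    also have "\<dots> \<le> \<eta> * norm (d k)"
      by (intro mult_right_mono) (simp_all add: \<eta>_def)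
    finally show ?thesis .
  qed

  \<comment> \<open>Sufficient decrease (b)\<close>
  have b: "c / 2 * (norm (d k))\<^sup>2 \<le> \<phi> (x k) - \<phi> (x (Suc k))" for k
  proof -
    \<comment> \<open>\<open>\<Omega>1\<close> is not assumed convex, but the domain of g is convex
      and contains both iterates.\<close>
    have "closed_segment (x k) (x (Suc k)) \<subseteq> \<Omega>1"
      using closed_segment_subset[OF xD xD convex_eff_dom[OF g_proper g_convex]] open_dom(2)
      by blast
    then have descent: "F (x (Suc k)) \<le> F (x k) + grad f (x k) \<bullet> d k + L_H / 2 * (norm (d k))\<^sup>2"
      unfolding d_def by (rule descent_lemma[OF _ der(1) f_Lip])
    have "G (x (Suc k)) + - (grad f (x k) + w k) \<bullet> (x k - x (Suc k)) \<le> G (x k)"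
      using sub[of k] xD[of k] by (simp add: subdifferential_real_iff[OF g_proper] G_def)
    moreover have "- (grad f (x k) + w k) \<bullet> (x k - x (Suc k)) = grad f (x k) \<bullet> d k + w k \<bullet> d k"
      by (simp add: d_def algebra_simps)
    ultimately have subgr: "G (x (Suc k)) + grad f (x k) \<bullet> d k + w k \<bullet> d k \<le> G (x k)"
      by simp
    have "- (\<epsilon> k \<bullet> d k) \<le> norm (\<epsilon> k) * norm (d k)"
      using Cauchy_Schwarz_ineq2[of "\<epsilon> k" "d k"] by simp
    also have "\<dots> \<le> (\<mu>2 / 2 * r k * norm (d k)) * norm (d k)"
      by (intro mult_right_mono \<epsilon>) simp
    also have "\<dots> \<le> (\<mu>1 * r k * norm (d k)) * norm (d k)"
      using mu1 mu2 r[of k] by (intro mult_right_mono) auto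
    also have "\<dots> = \<mu>1 * r k * (norm (d k))\<^sup>2"
      by (simp add: power2_eq_square)
    \<comment> \<open>The regularization term \<open>\<mu>1 * r k\<close> in the model matrix
      absorbs the inexactness, leaving the full L_H + c as curvature.\<close>
    finally have err: "- (\<epsilon> k \<bullet> d k) \<le> \<mu>1 * r k * (norm (d k))\<^sup>2" .
    have "w k \<bullet> d k = d k \<bullet> (B k *v d k) + (L_H + c + \<mu>1 * r k) * (norm (d k))\<^sup>2 + \<epsilon> k \<bullet> d k"
      unfolding w_def H inner_add_left by (simp add: inner_commute power2_norm_eq_inner)
    with err B(2)[where v = "d k"] have "(L_H + c) * (norm (d k))\<^sup>2 \<le> w k \<bullet> d k"
      by (simp add: distrib_right)
    \<comment> \<open>The descent lemma consumes L_H / 2; at least c / 2 remains for the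
      decrease.\<close>
    moreover have "(L_H / 2 + c / 2) * (norm (d k))\<^sup>2 \<le> (L_H + c) * (norm (d k))\<^sup>2"
      using L c by (intro mult_right_mono) auto
    ultimately show ?thesis
      using descent subgr by (simp add: \<phi>_def distrib_right)
  qed

  \<comment> \<open>Finite optimal value and telescoping of the decrease\<close>
  obtain xs where "xs \<in> solution_set f g" using sol by blast
  then have xs: "obj f g xs \<le> obj f g y" for y
    by (auto simp: solution_set_def is_arg_min_def not_less)
  have "obj f g xs < \<infinity>"
    using xs[of "x 0"] obj[OF start] by auto
  then have xsD: "xs \<in> ?D"
    using f_val[of xs] by (auto simp: obj_def eff_dom_def)
  have "opt_val f g = obj f g xs"
    unfolding opt_val_def by (rule antisym) (auto intro: INF_lower INF_greatest xs)
  then have opt: "opt_val f g = ereal (\<phi> xs)" using obj[OF xsD] by simp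
  have tele: "(\<Sum>j<k. c / 2 * (norm (d j))\<^sup>2) \<le> \<phi> (x 0) - \<phi> (x k)" for k
  proof (induction k)
    case (Suc k)
    then show ?case using b[of k] by simp
  qed simp
  have \<phi>_le: "\<phi> (x k) \<le> \<phi> (x 0)" for k
  proof -
    have "0 \<le> (\<Sum>j<k. c / 2 * (norm (d j))\<^sup>2)" using c by (intro sum_nonneg) auto
    then show ?thesis using tele[of k] by linarith
  qed
  have tele_opt: "(\<Sum>j<k. c / 2 * (norm (d j))\<^sup>2) \<le> \<phi> (x 0) - \<phi> xs" for k
  proof -
    have "\<phi> xs \<le> \<phi> (x k)" using xs[of "x k"] obj[OF xD] obj[OF xsD] by simp
    then show ?thesis using tele[of k] by linarith
  qed

  \<comment> \<open>Vanishing steps and cluster points (c)\<close>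
  have "summable (\<lambda>j. c / 2 * (norm (d j))\<^sup>2)"
    using c tele_opt by (intro summableI_nonneg_bounded) auto
  then have "(\<lambda>j. (norm (d j))\<^sup>2) \<longlonglongrightarrow> 0"
    using c by (intro summable_LIMSEQ_zero) (simp add: summable_cmult_iff)
  then have "(\<lambda>j. sqrt ((norm (d j))\<^sup>2)) \<longlonglongrightarrow> sqrt 0"
    by (rule tendsto_real_sqrt)
  then have d0: "d \<longlonglongrightarrow> 0"
    by (simp add: tendsto_norm_zero_iff)
  then have step: "(\<lambda>k. x (Suc k) - x k) \<longlonglongrightarrow> 0"
    unfolding d_def[abs_def] .
  have w0: "w \<longlonglongrightarrow> 0"
  proof (rule Lim_null_comparison)
    show "\<forall>\<^sub>F k in sequentially. norm (w k) \<le> (M + L_H + c + 3/2) * norm (d k)"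
      using norm_w by simp
    show "(\<lambda>k. (M + L_H + c + 3/2) * norm (d k)) \<longlonglongrightarrow> 0"
      using tendsto_mult_right_zero[OF tendsto_norm_zero[OF d0]] .
  qed
  have bdd: "bounded (range x)"
    using level[OF start] by (rule bounded_subset) (use obj[OF xD] \<phi>_le in auto)
  have stat: "cluster_points x \<subseteq> stationary_points f g"
  proof
    fix l assume "l \<in> cluster_points x"
    then obtain s :: "nat \<Rightarrow> nat" where s: "strict_mono s" "(\<lambda>j. x (s j)) \<longlonglongrightarrow> l"
      by (auto simp: cluster_points_def o_def)
    have "Cauchy (\<lambda>j. grad f (x (s j)))"
    proof (rule uniformly_continuous_on_Cauchy[where S = \<Omega>1 and X = "\<lambda>j. x (s j)"])
      show "uniformly_continuous_on \<Omega>1 (grad f)"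
        using f_Lip by (rule lipschitz_on_uniformly_continuous)
    qed (use s(2) xD open_dom(2) in \<open>auto intro: LIMSEQ_imp_Cauchy\<close>)
    then obtain v where v: "(\<lambda>j. grad f (x (s j))) \<longlonglongrightarrow> v"
      using Cauchy_convergent_iff convergent_def by blast
    have "(\<lambda>j. - (grad f (x (s j)) + w (s j))) \<longlonglongrightarrow> - (v + 0)"
      using LIMSEQ_subseq_LIMSEQ[OF w0 s(1)] by (intro tendsto_intros v) (simp add: o_def)
    \<comment> \<open>The gradients are taken at \<open>x (s j)\<close> but the subgradients live at
      \<open>x (Suc (s j))\<close>; vanishing steps give both sequences the limit l.\<close>
    then have "- (v + 0) \<in> subdifferential g l"
      by (rule subdifferential_closed_graph[OF g_proper g_lsc tendsto_Suc_subseq[OF step s] _ sub])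
    then have v_sub: "- v \<in> subdifferential g l" by simp
    \<comment> \<open>The limit \<open>v\<close> had to be found by completeness: only now is \<open>l\<close> known to lie in \<open>\<Omega>1\<close>,
      where \<open>grad f\<close> is continuous.\<close>
    then have "l \<in> \<Omega>1"
      using open_dom(2) by (auto simp: subdifferential_real_iff[OF g_proper])
    then have "(\<lambda>j. grad f (x (s j))) \<longlonglongrightarrow> grad f l"
      using der(2) s(2) isCont_tendsto_compose by blast
    with v have "v = grad f l" by (rule LIMSEQ_unique)
    with v_sub show "l \<in> stationary_points f g"
      unfolding stationary_points_def by force
  qed

  \<comment> \<open>Convergence rate (d)\<close>
  have rate: "Min (res ` {0..k}) \<le> sqrt (\<zeta> * (\<phi> (x 0) - \<phi> xs)) / sqrt (real (k + 1))" for k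
  proof -
    let ?m = "Min (res ` {0..k})"
    have m0: "0 \<le> ?m" by (subst Min_ge_iff) (auto simp: res_def)
    \<comment> \<open>The factor c / 2 matches the summands of \<open>tele_opt\<close>. Adding the k
      + 1 inequalities and multiplying by 2 / c produces \<open>\<zeta>\<close>.\<close>
    have "?m\<^sup>2 * (c / 2) \<le> \<eta>\<^sup>2 * (c / 2 * (norm (d j))\<^sup>2)" if "j < Suc k" for j
    proof -
      have "?m \<le> res j" using that by (intro Min_le) auto
      also have "\<dots> \<le> \<eta> * norm (d j)" by (rule a)
      finally have "?m\<^sup>2 \<le> (\<eta> * norm (d j))\<^sup>2" using m0 by (rule power_mono)
      then have "?m\<^sup>2 * (c / 2) \<le> (\<eta> * norm (d j))\<^sup>2 * (c / 2)"
        using c by (intro mult_right_mono) auto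
      then show ?thesis by (simp add: power_mult_distrib algebra_simps)
    qed
    then have "(\<Sum>j<Suc k. ?m\<^sup>2 * (c / 2)) \<le> (\<Sum>j<Suc k. \<eta>\<^sup>2 * (c / 2 * (norm (d j))\<^sup>2))"
      by (intro sum_mono) auto
    also have "\<dots> \<le> \<eta>\<^sup>2 * (\<phi> (x 0) - \<phi> xs)"
      using mult_left_mono[OF tele_opt zero_le_power2] by (simp only: sum_distrib_left)
    finally have le: "real (k + 1) * (?m\<^sup>2 * (c / 2)) \<le> \<eta>\<^sup>2 * (\<phi> (x 0) - \<phi> xs)"
      by (simp del: sum.lessThan_Suc)
    have "?m\<^sup>2 * real (k + 1) = 2 / c * (real (k + 1) * (?m\<^sup>2 * (c / 2)))"
      using c by simp
    also have "\<dots> \<le> 2 / c * (\<eta>\<^sup>2 * (\<phi> (x 0) - \<phi> xs))"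
      using c by (intro mult_left_mono le) simp
    also have "\<dots> = \<zeta> * (\<phi> (x 0) - \<phi> xs)"
      by (simp add: \<zeta>_def)
    finally have "?m\<^sup>2 \<le> \<zeta> * (\<phi> (x 0) - \<phi> xs) / real (k + 1)"
      by (simp add: pos_le_divide_eq)
    then show ?thesis
      unfolding real_sqrt_divide[symmetric] by (rule real_le_rsqrt)
  qed

  show ?thesis
    using a b stat rate cluster_points_nonempty[OF bdd] closed_cluster_points[of x]
      connected_cluster_points[OF bdd step]
    by (simp add: obj[OF xD] opt d_def res_def)
qed

end
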